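(* For any positive integers $m, n$ with $m \neq n$, the quandle $\operatorname{Conj}_m(\operatorname{PGL}(2,\mathbb{C}))$ is not isomorphic to the quandle $\operatorname{Conj}_n(\operatorname{PGL}(2,\mathbb{C}))$.
   Context: A quandle is a non-empty set $Q$ with a binary operation $*$ such that: (Q1) $x*x=x$ for all $x$; (Q2) for all $x,y\in Q$ there is a unique $z\in Q$ with $x=z*y$; (Q3) $(x*y)*z=(x*z)*(y*z)$ for all $x,y,z$. A quandle homomorphism is a map $\phi$ with $\phi(x*y)=\phi(x)*\phi(y)$; an isomorphism is a bijective homomorphism. For a group $G$ and an integer $n$, $\operatorname{Conj}_n(G)$ (the $n$-conjugation quandle of $G$) is the set $G$ with operation $x*y=y^{-n}xy^{n}$. $\operatorname{PGL}(2,\mathbb{C})$ is the quotient of $\operatorname{GL}(2,\mathbb{C})$ by its center (the nonzero scalar matrices). *)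

theory Defs
  imports "HOL-Analysis.Analysis" "HOL-Algebra.Coset"
begin

section \<open>Quandles\<close>

record 'a quandle = "'a partial_object" +
  qop :: "'a \<Rightarrow> 'a \<Rightarrow> 'a"  (infixl \<open>\<triangleright>\<index>\<close> 70)

locale quandle =
  fixes Q (structure)
  assumes nonempty: "carrier Q \<noteq> {}"
    and closed: "\<lbrakk>x \<in> carrier Q; y \<in> carrier Q\<rbrakk> \<Longrightarrow> x \<triangleright> y \<in> carrier Q"
    and idem: "x \<in> carrier Q \<Longrightarrow> x \<triangleright> x = x"
    and right_div: "\<lbrakk>x \<in> carrier Q; y \<in> carrier Q\<rbrakk> \<Longrightarrow> \<exists>!z. z \<in> carrier Q \<and> x = z \<triangleright> y"
    and right_distrib: "\<lbrakk>x \<in> carrier Q; y \<in> carrier Q; z \<in> carrier Q\<rbrakk> \<Longrightarrow>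
      (x \<triangleright> y) \<triangleright> z = (x \<triangleright> z) \<triangleright> (y \<triangleright> z)"

definition quandle_hom ::
  "('a, 'c) quandle_scheme \<Rightarrow> ('b, 'd) quandle_scheme \<Rightarrow> ('a \<Rightarrow> 'b) set" where
  "quandle_hom Q R = {\<phi>. \<phi> \<in> carrier Q \<rightarrow> carrier R \<and>
     (\<forall>x\<in>carrier Q. \<forall>y\<in>carrier Q. \<phi> (x \<triangleright>\<^bsub>Q\<^esub> y) = \<phi> x \<triangleright>\<^bsub>R\<^esub> \<phi> y)}"

definition quandle_iso ::
  "('a, 'c) quandle_scheme \<Rightarrow> ('b, 'd) quandle_scheme \<Rightarrow> ('a \<Rightarrow> 'b) set" where
  "quandle_iso Q R = {\<phi> \<in> quandle_hom Q R. bij_betw \<phi> (carrier Q) (carrier R)}"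

definition quandle_isomorphic ::
  "('a, 'c) quandle_scheme \<Rightarrow> ('b, 'd) quandle_scheme \<Rightarrow> bool"  (infix \<open>\<cong>\<^sub>q\<close> 60) where
  "Q \<cong>\<^sub>q R \<longleftrightarrow> quandle_iso Q R \<noteq> {}"

definition Conj :: "int \<Rightarrow> ('a, 'b) monoid_scheme \<Rightarrow> 'a quandle" where
  "Conj n G = \<lparr>carrier = carrier G,
     qop = (\<lambda>x y. y [^]\<^bsub>G\<^esub> (- n) \<otimes>\<^bsub>G\<^esub> x \<otimes>\<^bsub>G\<^esub> y [^]\<^bsub>G\<^esub> n)\<rparr>"

lemma (in group) cancel_inv:
  assumes "u \<in> carrier G" "c \<in> carrier G"
  shows "u \<otimes> (inv u \<otimes> c) = c" "inv u \<otimes> (u \<otimes> c) = c"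
  using assms by (simp_all add: m_assoc[symmetric])

lemma (in group) quandle_Conj: "quandle (Conj n G)"
proof -
  have pow_conj: "(inv u \<otimes> y \<otimes> u) [^] k = inv u \<otimes> y [^] k \<otimes> u"
    if u: "u \<in> carrier G" and y: "y \<in> carrier G" for u y and k :: int
  proof -
    have "(\<lambda>x. inv u \<otimes> x \<otimes> u) \<in> hom G G"
    proof (rule homI)
      fix a b assume ab: "a \<in> carrier G" "b \<in> carrier G"
      then show "inv u \<otimes> (a \<otimes> b) \<otimes> u = (inv u \<otimes> a \<otimes> u) \<otimes> (inv u \<otimes> b \<otimes> u)"
        using u by (simp add: m_assoc cancel_inv)
    qed (use u in auto)
    from hom_int_pow[OF this y is_group is_group, of k] show ?thesis by simp
  qed
  show ?thesis
  proof
    show "carrier (Conj n G) \<noteq> {}"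
      by (auto simp: Conj_def)
  next
    fix x y assume "x \<in> carrier (Conj n G)" "y \<in> carrier (Conj n G)"
    then show "x \<triangleright>\<^bsub>Conj n G\<^esub> y \<in> carrier (Conj n G)"
      by (simp add: Conj_def)
  next
    fix x assume "x \<in> carrier (Conj n G)"
    then have x: "x \<in> carrier G" by (simp add: Conj_def)
    then have "x [^] (- n) \<otimes> x \<otimes> x [^] n = x [^] (- n + 1 + n)"
      by (simp only: int_pow_mult[OF x] int_pow_1)
    then show "x \<triangleright>\<^bsub>Conj n G\<^esub> x = x"
      using x by (simp add: Conj_def int_pow_1)
  next
    fix x y assume "x \<in> carrier (Conj n G)" "y \<in> carrier (Conj n G)"
    then have xy: "x \<in> carrier G" "y \<in> carrier G" by (simp_all add: Conj_def)
    show "\<exists>!z. z \<in> carrier (Conj n G) \<and> x = z \<triangleright>\<^bsub>Conj n G\<^esub> y"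
      by (rule ex1I[of _ "y [^] n \<otimes> x \<otimes> inv (y [^] n)"])
        (use xy in \<open>auto simp: Conj_def int_pow_neg m_assoc cancel_inv\<close>)
  next
    fix x y z
    assume "x \<in> carrier (Conj n G)" "y \<in> carrier (Conj n G)" "z \<in> carrier (Conj n G)"
    then have xyz: "x \<in> carrier G" "y \<in> carrier G" "z \<in> carrier G" by (simp_all add: Conj_def)
    define u v where "u = z [^] n" and "v = y [^] n"
    have uv: "u \<in> carrier G" "v \<in> carrier G" using xyz by (auto simp: u_def v_def)
    have "inv u \<otimes> (inv v \<otimes> x \<otimes> v) \<otimes> u =
        inv (inv u \<otimes> v \<otimes> u) \<otimes> (inv u \<otimes> x \<otimes> u) \<otimes> (inv u \<otimes> v \<otimes> u)"
      using uv xyz by (simp add: m_assoc inv_mult_group cancel_inv)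
    then show "(x \<triangleright>\<^bsub>Conj n G\<^esub> y) \<triangleright>\<^bsub>Conj n G\<^esub> z =
        (x \<triangleright>\<^bsub>Conj n G\<^esub> z) \<triangleright>\<^bsub>Conj n G\<^esub> (y \<triangleright>\<^bsub>Conj n G\<^esub> z)"
      using xyz uv pow_conj[of u y n]
      by (simp add: Conj_def int_pow_neg u_def v_def)
  qed
qed

section \<open>The projective linear group\<close>

definition group_center :: "('a, 'b) monoid_scheme \<Rightarrow> 'a set" where
  "group_center G = {z \<in> carrier G. \<forall>x\<in>carrier G. z \<otimes>\<^bsub>G\<^esub> x = x \<otimes>\<^bsub>G\<^esub> z}"

lemma (in group) group_center_normal: "group_center G \<lhd> G"
proof -
  have "subgroup (group_center G) G"
  proof (rule subgroupI)
    show "group_center G \<subseteq> carrier G" by (auto simp: group_center_def)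
    show "group_center G \<noteq> {}" unfolding group_center_def by force
  next
    fix a assume "a \<in> group_center G"
    then have a: "a \<in> carrier G" and comm: "\<And>x. x \<in> carrier G \<Longrightarrow> a \<otimes> x = x \<otimes> a"
      by (auto simp: group_center_def)
    have "inv a \<otimes> x = x \<otimes> inv a" if x: "x \<in> carrier G" for x
    proof -
      have "inv a \<otimes> (a \<otimes> x) \<otimes> inv a = inv a \<otimes> (x \<otimes> a) \<otimes> inv a"
        by (simp only: comm[OF x])
      then show ?thesis
        using a x by (simp add: m_assoc cancel_inv)
    qed
    then show "inv a \<in> group_center G"
      using a by (simp add: group_center_def)
  next
    fix a b assume "a \<in> group_center G" "b \<in> group_center G"
    then have ab: "a \<in> carrier G" "b \<in> carrier G"
      and comm: "\<And>x. x \<in> carrier G \<Longrightarrow> a \<otimes> x = x \<otimes> a" "\<And>x. x \<in> carrier G \<Longrightarrow> b \<otimes> x = x \<otimes> b"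
      by (auto simp: group_center_def)
    have "a \<otimes> b \<otimes> x = x \<otimes> (a \<otimes> b)" if x: "x \<in> carrier G" for x
    proof -
      have "a \<otimes> b \<otimes> x = a \<otimes> x \<otimes> b" using ab x comm(2)[OF x] by (simp add: m_assoc)
      also have "\<dots> = x \<otimes> (a \<otimes> b)" using ab x comm(1)[OF x] by (simp add: m_assoc)
      finally show ?thesis .
    qed
    then show "a \<otimes> b \<in> group_center G"
      using ab by (simp add: group_center_def)
  qed
  moreover have "x \<otimes> h \<otimes> inv x \<in> group_center G"
    if "x \<in> carrier G" "h \<in> group_center G" for x h
  proof -
    have h: "h \<in> carrier G" "h \<otimes> x = x \<otimes> h"
      using that by (auto simp: group_center_def)
    then have "x \<otimes> h \<otimes> inv x = h"
      using that(1) by (metis inv_closed m_assoc r_inv r_one)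
    then show ?thesis using that(2) by simp
  qed
  ultimately show ?thesis
    by (simp add: normal_inv_iff)
qed

text \<open>The dimension is the cardinality of the finite index type \<open>'n\<close>.\<close>

definition GL :: "('a::field ^ 'n::finite ^ 'n) monoid" where
  "GL = \<lparr>carrier = {A. invertible A}, mult = (**), one = mat 1\<rparr>"

definition PGL :: "('a::field ^ 'n::finite ^ 'n) set monoid" where
  "PGL = GL Mod (group_center GL)"

lemma group_GL: "group (GL :: ('a::field ^ 'n::finite ^ 'n) monoid)"
proof (rule groupI)
  fix A :: "'a ^ 'n ^ 'n" assume "A \<in> carrier GL"
  then obtain B where "A ** B = mat 1" "B ** A = mat 1"
    by (auto simp: GL_def invertible_def)
  then show "\<exists>B\<in>carrier GL. B \<otimes>\<^bsub>GL\<^esub> A = \<one>\<^bsub>GL\<^esub>"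
    by (auto simp: GL_def invertible_def)
next
  show "\<one>\<^bsub>GL\<^esub> \<in> carrier (GL :: ('a ^ 'n ^ 'n) monoid)"
    by (auto simp: GL_def invertible_def intro: exI[of _ "mat 1"])
qed (auto simp: GL_def invertible_mult matrix_mul_assoc)

lemma group_PGL: "group (PGL :: ('a::field ^ 'n::finite ^ 'n) set monoid)"
  unfolding PGL_def
  by (rule normal.factorgroup_is_group[OF group.group_center_normal[OF group_GL]])

lemma group_center_GL:
  "group_center (GL :: ('a::field ^ 'n::finite ^ 'n) monoid) = {mat c | c. c \<noteq> 0}"
proof (intro equalityI subsetI)
  fix A :: "'a ^ 'n ^ 'n" assume A: "A \<in> group_center GL"
  have inv: "invertible A" using A by (simp add: group_center_def GL_def)
  define E :: "'n \<Rightarrow> 'n \<Rightarrow> 'a ^ 'n ^ 'n" where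
    "E = (\<lambda>i j. \<chi> k l. if k = i \<and> l = j then 1 else 0)"
  have AE: "(A ** E i j) $ k $ l = (if l = j then A $ k $ i else 0)" for i j k l
    by (simp add: matrix_matrix_mult_def E_def if_distrib cong: if_cong)
  have EA: "(E i j ** A) $ k $ l = (if k = i then A $ j $ l else 0)" for i j k l
    by (simp add: matrix_matrix_mult_def E_def if_distrib if_distribR cong: if_cong)
  have EE: "E i j ** E i j = 0" if "i \<noteq> j" for i j
    using that
    by (auto simp: matrix_matrix_mult_def E_def vec_eq_iff intro!: sum.neutral)
  have distrib:
    "(B + C) ** D = B ** D + C ** D" "(B - C) ** D = B ** D - C ** D"
    "D ** (B + C) = D ** B + D ** C" "D ** (B - C) = D ** B - D ** C" for B C D :: "'a ^ 'n ^ 'n"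
    by (simp_all add: matrix_matrix_mult_def vec_eq_iff algebra_simps sum.distrib sum_subtractf)
  have comm: "A ** E i j = E i j ** A" if ij: "i \<noteq> j" for i j
  proof -
    have "(mat 1 + E i j) ** (mat 1 - E i j) = mat 1" "(mat 1 - E i j) ** (mat 1 + E i j) = mat 1"
      using EE[OF ij]
      by (simp_all add: distrib)
    then have "invertible (mat 1 + E i j)"
      unfolding invertible_def by blast
    then have "A ** (mat 1 + E i j) = (mat 1 + E i j) ** A"
      using A by (simp add: group_center_def GL_def)
    then show ?thesis
      by (simp add: distrib)
  qed
  have off: "A $ k $ i = 0" if "k \<noteq> i" for k i
    using AE[of i k k k] EA[of i k k k] comm[of i k] that by simp
  have diag: "A $ i $ i = A $ j $ j" for i j
    using AE[of i j i j] EA[of i j i j] comm[of i j] by (cases "i = j") simp_all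
  obtain i :: 'n where True by simp
  have eq: "A = mat (A $ i $ i)"
    using off diag by (simp add: vec_eq_iff mat_def)
  moreover have "A $ i $ i \<noteq> 0"
  proof
    assume "A $ i $ i = 0"
    with eq have "A = 0" by (simp add: mat_def vec_eq_iff)
    with inv have "(0 :: 'a ^ 'n ^ 'n) = mat 1"
      by (auto simp: invertible_def)
    then have "(0 :: 'a ^ 'n ^ 'n) $ i $ i = mat 1 $ i $ i" by simp
    then show False by (simp add: mat_def)
  qed
  ultimately show "A \<in> {mat c | c. c \<noteq> 0}" by blast
next
  fix A :: "'a ^ 'n ^ 'n" assume "A \<in> {mat c | c. c \<noteq> 0}"
  then obtain c where A: "A = mat c" and c: "c \<noteq> 0" by blast
  have l: "mat d ** B = (\<chi> k l. d * B $ k $ l)" for d and B :: "'a ^ 'n ^ 'n"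
    by (simp add: matrix_matrix_mult_def mat_def vec_eq_iff if_distrib if_distribR cong: if_cong)
  have r: "B ** mat d = (\<chi> k l. d * B $ k $ l)" for d and B :: "'a ^ 'n ^ 'n"
    by (simp add: matrix_matrix_mult_def mat_def vec_eq_iff if_distrib if_distribR mult.commute cong: if_cong)
  have "mat c ** mat (inverse c) = (mat 1 :: 'a ^ 'n ^ 'n)"
    "mat (inverse c) ** mat c = (mat 1 :: 'a ^ 'n ^ 'n)"
    using c by (simp_all add: l) (simp_all add: mat_def vec_eq_iff)
  then have "invertible A" unfolding A invertible_def by blast
  then show "A \<in> group_center GL"
    by (simp add: group_center_def GL_def A l r)
qed

end

theory Submission
  imports Defs
begin

text \<open>
  The number \<open>n\<close> can be read off from the quandle \<open>Conj n PGL\<close>. Call \<open>y\<close> inert if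
  acting with \<open>y\<close> moves nothing. As \<open>PGL\<close> has trivial centre, \<open>y\<close> is inert in
  \<open>Conj n PGL\<close> iff \<open>y\<close> has order dividing \<open>n\<close>. Counting such elements is useless, since
  there are infinitely many of them for \<open>n > 1\<close>; they have to be confined to a single torus, and
  this can be done in the language of quandles. For an inert \<open>z\<close>, let \<open>S z\<close>
  (\<open>dominated\<close> below) be the set of all inert \<open>y\<close> that are fixed by every \<open>u\<close> fixing
  \<open>z\<close>. Then \<open>n\<close> is the largest cardinality of a set \<open>S z\<close> with \<open>z\<close> inert.

  For the upper bound (\<open>card_dominated_PGL_le\<close>), note that an invertible complex matrix is
  diagonalisable as soon as one of its positive powers is scalar, so that up to an inner
  automorphism \<open>z\<close> is the class of a diagonal matrix. This class is fixed by any \<open>u\<close> whose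
  \<open>n\<close>-th power is the class of \<open>diag(2, 1)\<close>, and the centraliser of the latter is the
  diagonal torus \<open>{diag(\<mu>, 1)}\<close>. Hence \<open>S z\<close> lies in the \<open>n\<close>-torsion of this torus,
  which has \<open>n\<close> elements.

  For \<open>z = diag(\<zeta>, 1)\<close> with a primitive \<open>n\<close>-th root of unity \<open>\<zeta>\<close>, this torsion group
  consists of the powers of \<open>z\<close>; whatever commutes with \<open>z\<close> commutes with these, so they all
  belong to \<open>S z\<close> and the bound is attained (\<open>card_dominated_PGL_attained\<close>).
\<close>

section \<open>An isomorphism invariant of quandles\<close>

definition inert :: "('a, 'c) quandle_scheme \<Rightarrow> 'a set" where
  "inert Q = {y \<in> carrier Q. \<forall>x\<in>carrier Q. x \<triangleright>\<^bsub>Q\<^esub> y = x}"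

definition fixers :: "('a, 'c) quandle_scheme \<Rightarrow> 'a \<Rightarrow> 'a set" where
  "fixers Q z = {u \<in> carrier Q. z \<triangleright>\<^bsub>Q\<^esub> u = z}"

text \<open>
  Inert elements all act in the same way, so only the actions of other elements on them can tell
  them apart.
\<close>

definition dominated :: "('a, 'c) quandle_scheme \<Rightarrow> 'a \<Rightarrow> 'a set" where
  "dominated Q z = {y \<in> inert Q. fixers Q z \<subseteq> fixers Q y}"

lemma quandle_isoD:
  assumes "\<phi> \<in> quandle_iso Q R"
  shows "bij_betw \<phi> (carrier Q) (carrier R)"
    and "\<lbrakk>x \<in> carrier Q; y \<in> carrier Q\<rbrakk> \<Longrightarrow> \<phi> (x \<triangleright>\<^bsub>Q\<^esub> y) = \<phi> x \<triangleright>\<^bsub>R\<^esub> \<phi> y"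
  using assms by (auto simp: quandle_iso_def quandle_hom_def)

lemma quandle_iso_fixes_iff:
  assumes "quandle Q" "\<phi> \<in> quandle_iso Q R" "x \<in> carrier Q" "y \<in> carrier Q"
  shows "\<phi> x \<triangleright>\<^bsub>R\<^esub> \<phi> y = \<phi> x \<longleftrightarrow> x \<triangleright>\<^bsub>Q\<^esub> y = x"
  using quandle_isoD[OF assms(2)] assms(3,4) quandle.closed[OF assms(1,3,4)]
  by (metis bij_betw_inv_into_left)

lemma quandle_iso_inert_iff:
  assumes "quandle Q" "\<phi> \<in> quandle_iso Q R" "y \<in> carrier Q"
  shows "\<phi> y \<in> inert R \<longleftrightarrow> y \<in> inert Q"
proof -
  have im: "carrier R = \<phi> ` carrier Q"
    using quandle_isoD(1)[OF assms(2)] by (simp add: bij_betw_def)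
  show ?thesis
    unfolding inert_def im
    using assms(3) quandle_iso_fixes_iff[OF assms(1,2) _ assms(3)] by auto
qed

lemma quandle_iso_inert:
  assumes "quandle Q" "\<phi> \<in> quandle_iso Q R"
  shows "inert R = \<phi> ` inert Q"
proof -
  have im: "carrier R = \<phi> ` carrier Q"
    using quandle_isoD(1)[OF assms(2)] by (simp add: bij_betw_def)
  have "inert R \<subseteq> \<phi> ` carrier Q" "inert Q \<subseteq> carrier Q"
    by (auto simp: inert_def im)
  then show ?thesis
    using quandle_iso_inert_iff[OF assms] by blast
qed

lemma quandle_iso_dominated:
  assumes "quandle Q" "\<phi> \<in> quandle_iso Q R" "z \<in> carrier Q"
  shows "dominated R (\<phi> z) = \<phi> ` dominated Q z"
proof -
  have im: "carrier R = \<phi> ` carrier Q"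
    using quandle_isoD(1)[OF assms(2)] by (simp add: bij_betw_def)
  have sub: "fixers R (\<phi> z) \<subseteq> fixers R (\<phi> y) \<longleftrightarrow> fixers Q z \<subseteq> fixers Q y"
    if "y \<in> carrier Q" for y
  proof -
    have "fixers R (\<phi> x) = \<phi> ` fixers Q x" if "x \<in> carrier Q" for x
      unfolding fixers_def im using quandle_iso_fixes_iff[OF assms(1,2) that] by auto
    moreover have "inj_on \<phi> (carrier Q)" "fixers Q z \<subseteq> carrier Q" "fixers Q y \<subseteq> carrier Q"
      using quandle_isoD(1)[OF assms(2)] by (auto simp: bij_betw_def fixers_def)
    ultimately show ?thesis
      using that assms(3) by (simp add: inj_on_image_subset_iff)
  qed
  have "inert Q \<subseteq> carrier Q" by (auto simp: inert_def)
  then show ?thesis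
    unfolding dominated_def quandle_iso_inert[OF assms(1,2)]
    using sub by blast
qed

lemma quandle_iso_card_dominated:
  assumes "quandle Q" "\<phi> \<in> quandle_iso Q R" "z \<in> carrier Q"
  shows "card (dominated R (\<phi> z)) = card (dominated Q z)"
proof -
  have "dominated Q z \<subseteq> carrier Q" by (auto simp: dominated_def inert_def)
  then have "inj_on \<phi> (dominated Q z)"
    using quandle_isoD(1)[OF assms(2)] by (auto simp: bij_betw_def intro: inj_on_subset)
  then show ?thesis
    by (simp add: quandle_iso_dominated[OF assms] card_image)
qed

section \<open>Conjugation quandles\<close>

lemma carrier_Conj [simp]: "carrier (Conj n G) = carrier G"
  by (simp add: Conj_def)

context group
begin

lemma Conj_fixes_iff:
  assumes "x \<in> carrier G" "y \<in> carrier G"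
  shows "x \<triangleright>\<^bsub>Conj (int n) G\<^esub> y = x \<longleftrightarrow> x \<otimes> y [^] n = y [^] n \<otimes> x"
proof -
  have "x \<triangleright>\<^bsub>Conj (int n) G\<^esub> y = inv (y [^] n) \<otimes> (x \<otimes> y [^] n)"
    using assms by (simp add: Conj_def int_pow_neg int_pow_int m_assoc)
  moreover have "inv (y [^] n) \<otimes> (x \<otimes> y [^] n) = x \<longleftrightarrow> x \<otimes> y [^] n = y [^] n \<otimes> x"
    using assms inv_solve_left[of x "y [^] n" "x \<otimes> y [^] n"] by fastforce
  ultimately show ?thesis by simp
qed

lemma inert_Conj:
  "inert (Conj (int n) G) = {y \<in> carrier G. \<forall>x\<in>carrier G. x \<otimes> y [^] n = y [^] n \<otimes> x}"
  by (auto simp: inert_def Conj_fixes_iff)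

lemma fixers_Conj:
  assumes "z \<in> carrier G"
  shows "fixers (Conj (int n) G) z = {u \<in> carrier G. z \<otimes> u [^] n = u [^] n \<otimes> z}"
  using assms by (auto simp: fixers_def Conj_fixes_iff)

text \<open>Used to replace a torsion element by a conjugate in the torus.\<close>

lemma inner_automorphism:
  assumes g: "g \<in> carrier G"
  shows "(\<lambda>x. inv g \<otimes> x \<otimes> g) \<in> quandle_iso (Conj (int n) G) (Conj (int n) G)"
proof -
  have hom: "(\<lambda>x. inv g \<otimes> x \<otimes> g) \<in> hom G G"
    using g by (auto intro!: homI simp: m_assoc cancel_inv)
  have pow: "(inv g \<otimes> y \<otimes> g) [^] k = inv g \<otimes> y [^] k \<otimes> g" if "y \<in> carrier G" for y and k :: int
    using hom_int_pow[OF hom that is_group is_group, of k] by simp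
  have "bij_betw (\<lambda>x. inv g \<otimes> x \<otimes> g) (carrier G) (carrier G)"
    by (rule bij_betw_byWitness[where f' = "\<lambda>x. g \<otimes> x \<otimes> inv g"])
      (use g in \<open>auto simp: m_assoc cancel_inv\<close>)
  moreover have "inv g \<otimes> (x \<triangleright>\<^bsub>Conj (int n) G\<^esub> y) \<otimes> g =
      (inv g \<otimes> x \<otimes> g) \<triangleright>\<^bsub>Conj (int n) G\<^esub> (inv g \<otimes> y \<otimes> g)"
    if "x \<in> carrier G" "y \<in> carrier G" for x y
    using that g by (simp add: Conj_def pow) (simp add: m_assoc cancel_inv)
  ultimately show ?thesis
    using g by (auto simp: quandle_iso_def quandle_hom_def)
qed

end

section \<open>Classes of two-by-two matrices\<close>

definition mat2 :: "complex \<Rightarrow> complex \<Rightarrow> complex \<Rightarrow> complex \<Rightarrow> complex ^ 2 ^ 2" where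
  "mat2 a b c d = vector [vector [a, b], vector [c, d]]"

definition proj :: "complex ^ 2 ^ 2 \<Rightarrow> (complex ^ 2 ^ 2) set" where
  "proj A = group_center GL #>\<^bsub>GL\<^esub> A"

lemma mat2_nth [simp]:
  "mat2 a b c d $ 1 $ 1 = a" "mat2 a b c d $ 1 $ 2 = b"
  "mat2 a b c d $ 2 $ 1 = c" "mat2 a b c d $ 2 $ 2 = d"
  by (simp_all add: mat2_def)

lemma mat2_eq_iff:
  "A = B \<longleftrightarrow> A $ 1 $ 1 = B $ 1 $ 1 \<and> A $ 1 $ 2 = B $ 1 $ 2 \<and> A $ 2 $ 1 = B $ 2 $ 1 \<and> A $ 2 $ 2 = B $ 2 $ 2"
  for A B :: "complex ^ 2 ^ 2"
  by (auto simp: vec_eq_iff forall_2)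

lemma mat2_cases: obtains a b c d where "A = mat2 a b c d"
proof
  show "A = mat2 (A $ 1 $ 1) (A $ 1 $ 2) (A $ 2 $ 1) (A $ 2 $ 2)"
    by (simp add: mat2_eq_iff)
qed

lemma mat2_inject [simp]:
  "mat2 a b c d = mat2 a' b' c' d' \<longleftrightarrow> a = a' \<and> b = b' \<and> c = c' \<and> d = d'"
  by (simp add: mat2_eq_iff)

lemma mat2_mult [simp]:
  "mat2 a b c d ** mat2 a' b' c' d' =
    mat2 (a * a' + b * c') (a * b' + b * d') (c * a' + d * c') (c * b' + d * d')"
  by (simp add: mat2_eq_iff matrix_matrix_mult_def sum_2)

lemma mat_eq_mat2: "mat k = mat2 k 0 0 k"
  by (simp add: mat2_eq_iff mat_def)

lemma mat2_in_GL [simp]: "mat2 a b c d \<in> carrier GL \<longleftrightarrow> a * d \<noteq> b * c"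
  by (simp add: GL_def invertible_det_nz det_2)

lemma mult_GL [simp]: "A \<otimes>\<^bsub>GL\<^esub> B = A ** B"
  by (simp add: GL_def)

lemma GL_pow_diag: "mat2 a 0 0 d [^]\<^bsub>GL\<^esub> (n::nat) = mat2 (a ^ n) 0 0 (d ^ n)"
  by (induction n) (simp_all add: nat_pow_def GL_def mat_eq_mat2 mult.commute)

interpretation GL: group "GL :: (complex ^ 2 ^ 2) monoid"
  by (rule group_GL)

interpretation PGL: group "PGL :: (complex ^ 2 ^ 2) set monoid"
  by (rule group_PGL)

lemma proj_hom: "proj \<in> hom GL PGL"
  using normal.r_coset_hom_Mod[OF GL.group_center_normal]
  by (simp add: proj_def[abs_def] PGL_def)

interpretation proj: group_hom GL PGL proj
  by unfold_locales (rule proj_hom)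

lemma PGL_cases:
  assumes "x \<in> carrier PGL"
  obtains A where "A \<in> carrier GL" "x = proj A"
  using assms by (auto simp: PGL_def carrier_FactGroup proj_def)

lemma proj_eq_iff:
  assumes "A \<in> carrier GL" "B \<in> carrier GL"
  shows "proj A = proj B \<longleftrightarrow> (\<exists>k. k \<noteq> 0 \<and> A = mat k ** B)"
proof -
  have sub: "subgroup (group_center GL) (GL :: (complex ^ 2 ^ 2) monoid)"
    using GL.group_center_normal by (rule normal_imp_subgroup)
  have "proj A = proj B \<longleftrightarrow> A \<in> proj B"
    unfolding proj_def
    using GL.repr_independence[OF _ assms(2) sub] GL.repr_independenceD[OF sub assms(1)] by metis
  also have "\<dots> \<longleftrightarrow> (\<exists>k. k \<noteq> 0 \<and> A = mat k ** B)"
    by (auto simp: proj_def r_coset_def group_center_GL)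
  finally show ?thesis .
qed

lemma proj_mat2_eq_iff:
  assumes "a * d \<noteq> b * c" "a' * d' \<noteq> b' * c'"
  shows "proj (mat2 a b c d) = proj (mat2 a' b' c' d') \<longleftrightarrow>
    (\<exists>k. k \<noteq> 0 \<and> a = k * a' \<and> b = k * b' \<and> c = k * c' \<and> d = k * d')"
  using assms by (simp add: proj_eq_iff mat_eq_mat2)

lemma proj_commute_iff:
  assumes "A \<in> carrier GL" "B \<in> carrier GL"
  shows "proj A \<otimes>\<^bsub>PGL\<^esub> proj B = proj B \<otimes>\<^bsub>PGL\<^esub> proj A \<longleftrightarrow>
    (\<exists>k. k \<noteq> 0 \<and> A ** B = mat k ** (B ** A))"
  using assms GL.m_closed[OF assms] GL.m_closed[OF assms(2,1)]
  by (simp add: proj_eq_iff flip: proj.hom_mult)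

section \<open>The diagonal torus\<close>

definition tor :: "complex \<Rightarrow> (complex ^ 2 ^ 2) set" where
  "tor \<mu> = proj (mat2 \<mu> 0 0 1)"

lemma tor_closed: "\<mu> \<noteq> 0 \<Longrightarrow> tor \<mu> \<in> carrier PGL"
  by (simp add: tor_def)

lemma proj_diag: "a \<noteq> 0 \<Longrightarrow> d \<noteq> 0 \<Longrightarrow> proj (mat2 a 0 0 d) = tor (a / d)"
  unfolding tor_def by (subst proj_mat2_eq_iff) auto

lemma tor_inject: "\<mu> \<noteq> 0 \<Longrightarrow> \<nu> \<noteq> 0 \<Longrightarrow> tor \<mu> = tor \<nu> \<longleftrightarrow> \<mu> = \<nu>"
  unfolding tor_def by (subst proj_mat2_eq_iff) auto

lemma tor_pow: "\<mu> \<noteq> 0 \<Longrightarrow> tor \<mu> [^]\<^bsub>PGL\<^esub> (n::nat) = tor (\<mu> ^ n)"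
  unfolding tor_def by (subst proj.hom_nat_pow[symmetric]) (simp_all add: GL_pow_diag)

lemma tor_1: "tor 1 = \<one>\<^bsub>PGL\<^esub>"
proof -
  have "mat2 1 0 0 1 = \<one>\<^bsub>GL\<^esub>" by (simp add: GL_def mat_eq_mat2)
  then show ?thesis by (simp add: tor_def)
qed

lemma tor_commute:
  "\<mu> \<noteq> 0 \<Longrightarrow> \<nu> \<noteq> 0 \<Longrightarrow> tor \<mu> \<otimes>\<^bsub>PGL\<^esub> tor \<nu> = tor \<nu> \<otimes>\<^bsub>PGL\<^esub> tor \<mu>"
  unfolding tor_def by (subst proj_commute_iff) (auto intro!: exI[of _ 1] simp: mat_eq_mat2 mult.commute)

text \<open>
  Commuting in \<open>PGL\<close> is commuting up to a scalar \<open>k\<close>. For \<open>k \<noteq> 1\<close> an antidiagonal matrix could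
  occur as well; it would force \<open>k = 2\<close> from one entry and \<open>k = 1 / 2\<close> from the other. This
  is why \<open>2\<close> appears here and \<open>-1\<close> would not do.
\<close>

lemma centraliser_tor_2:
  assumes "x \<in> carrier PGL" "x \<otimes>\<^bsub>PGL\<^esub> tor 2 = tor 2 \<otimes>\<^bsub>PGL\<^esub> x"
  obtains \<mu> where "\<mu> \<noteq> 0" "x = tor \<mu>"
proof -
  obtain A where A: "A \<in> carrier GL" "x = proj A" using PGL_cases[OF assms(1)] .
  obtain p q r s where A_eq: "A = mat2 p q r s" by (rule mat2_cases)
  have "\<exists>k. k \<noteq> 0 \<and> A ** mat2 2 0 0 1 = mat k ** (mat2 2 0 0 1 ** A)"
    using assms(2) A(1) by (subst proj_commute_iff[symmetric]) (simp_all add: A(2) tor_def)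
  then obtain k where k: "k \<noteq> 0" "p * 2 = k * (2 * p)" "q = k * (2 * q)" "r * 2 = k * r" "s = k * s"
    by (auto simp: A_eq mat_eq_mat2)
  have det: "p * s \<noteq> q * r" using A(1) by (simp add: A_eq)
  have "k = 1"
  proof (rule ccontr)
    assume "k \<noteq> 1"
    then have "p = 0" "s = 0" using k by auto
    then have "k * 2 = 1" "k = 2" using det k by auto
    then show False by simp
  qed
  then have "q = 0" "r = 0" using k by auto
  then have "p \<noteq> 0" "s \<noteq> 0" "x = tor (p / s)"
    using det A(2) by (auto simp: A_eq proj_diag)
  then show ?thesis using that[of "p / s"] by simp
qed

lemma tor_commutes_unipotent:
  assumes "\<mu> \<noteq> 0"
    and "tor \<mu> \<otimes>\<^bsub>PGL\<^esub> proj (mat2 1 1 0 1) = proj (mat2 1 1 0 1) \<otimes>\<^bsub>PGL\<^esub> tor \<mu>"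
  shows "\<mu> = 1"
proof -
  have "\<exists>k. k \<noteq> 0 \<and> mat2 \<mu> 0 0 1 ** mat2 1 1 0 1 = mat k ** (mat2 1 1 0 1 ** mat2 \<mu> 0 0 1)"
    using assms by (subst proj_commute_iff[symmetric]) (simp_all add: tor_def)
  then show ?thesis by (auto simp: mat_eq_mat2)
qed

text \<open>
  Commuting with \<open>tor 2\<close> puts a central element into the torus, and commuting with a unipotent
  element leaves only the identity there.
\<close>

lemma center_PGL:
  assumes "x \<in> carrier PGL" "\<And>y. y \<in> carrier PGL \<Longrightarrow> y \<otimes>\<^bsub>PGL\<^esub> x = x \<otimes>\<^bsub>PGL\<^esub> y"
  shows "x = \<one>\<^bsub>(PGL :: (complex ^ 2 ^ 2) set monoid)\<^esub>"
proof -
  have "x \<otimes>\<^bsub>PGL\<^esub> tor 2 = tor 2 \<otimes>\<^bsub>PGL\<^esub> x"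
    using assms(2)[of "tor 2"] by (simp add: tor_closed)
  then obtain \<mu> where \<mu>: "\<mu> \<noteq> 0" "x = tor \<mu>"
    using centraliser_tor_2[OF assms(1)] by blast
  then have "\<mu> = 1"
    using tor_commutes_unipotent assms(2)[of "proj (mat2 1 1 0 1)"] by simp
  then show ?thesis using \<mu> by (simp add: tor_1)
qed

lemma inert_PGL_iff:
  "y \<in> inert (Conj (int n) (PGL :: (complex ^ 2 ^ 2) set monoid)) \<longleftrightarrow>
    y \<in> carrier PGL \<and> y [^]\<^bsub>PGL\<^esub> n = \<one>\<^bsub>PGL\<^esub>"
  unfolding PGL.inert_Conj using center_PGL[of "y [^]\<^bsub>PGL\<^esub> n"] by auto

section \<open>Torsion elements are diagonalisable\<close>

text \<open>The columns of \<open>P\<close> are eigenvectors for the two distinct roots of the characteristic polynomial.\<close>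

lemma diagonalisable_if_discriminant_nonzero:
  assumes disc: "(p - s)\<^sup>2 + 4 * q * r \<noteq> 0"
  obtains P a d where "P \<in> carrier GL" "mat2 p q r s ** P = P ** mat2 a 0 0 d"
proof -
  define e where "e = csqrt ((p - s)\<^sup>2 + 4 * q * r)"
  have e2: "e * e = (p - s) * (p - s) + 4 * q * r"
    unfolding e_def by (metis power2_csqrt power2_eq_square)
  have e0: "e \<noteq> 0" using disc by (simp add: e_def)
  define a d where "a = (p + s + e) / 2" and "d = (p + s - e) / 2"
  have sum: "a + d = p + s" and diff: "a - d = e"
    by (simp_all add: a_def d_def field_simps)
  have root: "a * a = (p + s) * a - (p * s - q * r)" "d * d = (p + s) * d - (p * s - q * r)"
    using e2 sum diff by algebra+
  consider "r \<noteq> 0" | "r = 0" "q \<noteq> 0" "p \<noteq> s" | "r = 0" "q = 0"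
    using disc by fastforce
  then show ?thesis
  proof cases
    case 1
    have "mat2 p q r s ** mat2 (a - s) (d - s) r r = mat2 (a - s) (d - s) r r ** mat2 a 0 0 d"
      using root by (simp add: algebra_simps)
    moreover have "(a - s) * r \<noteq> (d - s) * r" using 1 e0 diff by auto
    ultimately show ?thesis using that[of "mat2 (a - s) (d - s) r r"] by simp
  next
    case 2
    have "mat2 p q r s ** mat2 1 q 0 (s - p) = mat2 1 q 0 (s - p) ** mat2 p 0 0 s"
      using 2 by (simp add: algebra_simps)
    then show ?thesis using that[of "mat2 1 q 0 (s - p)"] 2 by simp
  next
    case 3
    then show ?thesis using that[of "mat2 1 0 0 1" p s] by simp
  qed
qed

text \<open>
  If the discriminant of the characteristic polynomial vanishes, then the matrix is \<open>l + N\<close> with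
  \<open>N = mat2 f q r (- f)\<close> and, by Cayley--Hamilton, \<open>N ** N = 0\<close>. So its powers are linear in \<open>N\<close>.
\<close>

lemma GL_pow_nilpotent_part:
  assumes "f * f + q * r = 0"
  shows "mat2 (l + f) q r (l - f) [^]\<^bsub>GL\<^esub> (Suc n) =
    mat2 (l ^ Suc n + of_nat (Suc n) * l ^ n * f) (of_nat (Suc n) * l ^ n * q)
      (of_nat (Suc n) * l ^ n * r) (l ^ Suc n - of_nat (Suc n) * l ^ n * f)"
proof (induction n)
  case 0
  then show ?case by (simp add: nat_pow_def GL_def)
next
  case (Suc n)
  have qr: "q * r = - (f * f)" using assms by (simp add: add_eq_0_iff)
  have qr': "q * (r * c) = - (f * (f * c))" for c
    using qr by (metis mult.assoc mult_minus_left)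
  have "mat2 (l + f) q r (l - f) [^]\<^bsub>GL\<^esub> Suc (Suc n) =
      mat2 (l + f) q r (l - f) [^]\<^bsub>GL\<^esub> Suc n ** mat2 (l + f) q r (l - f)"
    by (simp only: GL.nat_pow_Suc mult_GL)
  then show ?case
    unfolding Suc.IH by (simp add: algebra_simps qr qr')
qed

text \<open>
  In the case of a double eigenvalue \<open>l\<close>, the off-diagonal part of a power is a nonzero multiple of
  that of \<open>N\<close>; it vanishes for a scalar power, and then the matrix is already diagonal.
\<close>

lemma torsion_diagonalisable:
  fixes n :: nat
  assumes A: "A \<in> carrier GL" and tors: "proj A [^]\<^bsub>PGL\<^esub> n = \<one>\<^bsub>PGL\<^esub>" and n: "n > 0"
  obtains P a d where "P \<in> carrier GL" "A ** P = P ** mat2 a 0 0 d"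
proof -
  obtain p q r s where A_eq: "A = mat2 p q r s" by (rule mat2_cases)
  have det: "p * s \<noteq> q * r" using A by (simp add: A_eq)
  show ?thesis
  proof (cases "(p - s)\<^sup>2 + 4 * q * r = 0")
    case False
    show ?thesis
      using diagonalisable_if_discriminant_nonzero[OF False] that unfolding A_eq by blast
  next
    case True
    define l f where "l = (p + s) / 2" and "f = (p - s) / 2"
    have ps: "p = l + f" "s = l - f" by (simp_all add: l_def f_def field_simps)
    have ff: "f * f + q * r = 0"
      using True by (simp add: f_def power2_eq_square field_simps)
    have l: "l \<noteq> 0"
    proof
      assume "l = 0"
      then have "p * s = q * r" using ff by (simp add: ps add_eq_0_iff)
      then show False using det by simp
    qed
    obtain k where k: "n = Suc k" using n gr0_implies_Suc by blast
    have "proj (A [^]\<^bsub>GL\<^esub> n) = proj (mat2 1 0 0 1)"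
      using tors A by (simp add: proj.hom_nat_pow tor_1[unfolded tor_def])
    then obtain c where "A [^]\<^bsub>GL\<^esub> n = mat c ** mat2 1 0 0 1"
      using A by (subst (asm) proj_eq_iff) auto
    then have "of_nat (Suc k) * l ^ k * q = 0" "of_nat (Suc k) * l ^ k * r = 0"
      unfolding A_eq ps k GL_pow_nilpotent_part[OF ff] by (simp_all add: mat_eq_mat2)
    then have "q = 0" "r = 0" using l by (auto simp del: of_nat_Suc)
    then show ?thesis using that[of "mat2 1 0 0 1" p s] by (simp add: A_eq)
  qed
qed

lemma torsion_conjugate_into_torus:
  fixes n :: nat
  assumes z: "z \<in> carrier PGL" "z [^]\<^bsub>PGL\<^esub> n = \<one>\<^bsub>PGL\<^esub>" and n: "n > 0"
  obtains g \<mu> where "g \<in> carrier PGL" "\<mu> \<noteq> 0" "inv\<^bsub>PGL\<^esub> g \<otimes>\<^bsub>PGL\<^esub> z \<otimes>\<^bsub>PGL\<^esub> g = tor \<mu>"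
proof -
  obtain A where A: "A \<in> carrier GL" "z = proj A" using PGL_cases[OF z(1)] .
  obtain P a d where P: "P \<in> carrier GL" "A ** P = P ** mat2 a 0 0 d"
    using torsion_diagonalisable[OF A(1) _ n] z(2) A(2) by metis
  have D: "inv\<^bsub>GL\<^esub> P \<otimes>\<^bsub>GL\<^esub> A \<otimes>\<^bsub>GL\<^esub> P = mat2 a 0 0 d"
  proof -
    have "inv\<^bsub>GL\<^esub> P \<otimes>\<^bsub>GL\<^esub> A \<otimes>\<^bsub>GL\<^esub> P = inv\<^bsub>GL\<^esub> P ** P ** mat2 a 0 0 d"
      by (simp add: P(2) flip: matrix_mul_assoc)
    also have "inv\<^bsub>GL\<^esub> P ** P = mat 1"
      using GL.l_inv[OF P(1)] by (simp add: GL_def)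
    finally show ?thesis by simp
  qed
  then have "mat2 a 0 0 d \<in> carrier GL"
    using P(1) A(1) by (metis GL.inv_closed GL.m_closed)
  then have ad: "a \<noteq> 0" "d \<noteq> 0" by auto
  have "inv\<^bsub>PGL\<^esub> (proj P) \<otimes>\<^bsub>PGL\<^esub> z \<otimes>\<^bsub>PGL\<^esub> proj P = proj (mat2 a 0 0 d)"
    using P(1) A by (simp flip: D add: proj.hom_mult del: mult_GL)
  also have "\<dots> = tor (a / d)" using ad by (rule proj_diag)
  finally show ?thesis using that[of "proj P" "a / d"] P(1) ad by simp
qed

section \<open>The invariant of the conjugation quandles\<close>

text \<open>
  All \<open>n\<close>-th powers of torus elements commute with \<open>tor \<mu>\<close>, and among them is \<open>tor 2\<close>,
  whose centraliser is the torus.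
\<close>

lemma dominated_tor_subset:
  assumes "\<mu> \<noteq> 0" and n: "n > 0"
  shows "dominated (Conj (int n) PGL) (tor \<mu>) \<subseteq> tor ` {\<nu>. \<nu> ^ n = 1}"
proof
  fix y assume "y \<in> dominated (Conj (int n) PGL) (tor \<mu>)"
  then have y: "y \<in> carrier PGL" "y [^]\<^bsub>PGL\<^esub> n = \<one>\<^bsub>PGL\<^esub>"
    and fix_y: "fixers (Conj (int n) PGL) (tor \<mu>) \<subseteq> fixers (Conj (int n) PGL) y"
    by (auto simp: dominated_def inert_PGL_iff)
  obtain \<rho> :: complex where \<rho>: "\<rho> ^ n = 2"
    using n card_nth_roots[of 2 n] by fastforce
  then have \<rho>0: "\<rho> \<noteq> 0" using n by (auto simp: power_0_left)
  have "tor \<rho> \<in> fixers (Conj (int n) PGL) (tor \<mu>)"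
    using assms \<rho> \<rho>0 by (simp add: PGL.fixers_Conj tor_closed tor_pow tor_commute)
  then have "y \<otimes>\<^bsub>PGL\<^esub> tor 2 = tor 2 \<otimes>\<^bsub>PGL\<^esub> y"
    using fix_y \<rho> \<rho>0 y(1) by (auto simp: PGL.fixers_Conj tor_pow)
  then obtain \<nu> where \<nu>: "\<nu> \<noteq> 0" "y = tor \<nu>"
    using centraliser_tor_2[OF y(1)] by blast
  have "tor (\<nu> ^ n) = tor 1" using y(2) \<nu> by (simp add: tor_pow tor_1)
  then show "y \<in> tor ` {\<nu>. \<nu> ^ n = 1}" using \<nu> by (simp add: tor_inject)
qed

lemma card_tor_roots_unity:
  assumes "n > 0"
  shows "finite (tor ` {\<nu>. \<nu> ^ n = 1})" and "card (tor ` {\<nu>. \<nu> ^ n = 1}) = n"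
proof -
  have "\<nu> \<noteq> 0" if "\<nu> ^ n = 1" for \<nu> :: complex
    using that assms by (auto simp: power_0_left)
  then have "inj_on tor {\<nu>. \<nu> ^ n = 1}"
    by (auto simp: inj_on_def tor_inject)
  then show "card (tor ` {\<nu>. \<nu> ^ n = 1}) = n"
    using assms by (simp add: card_image card_roots_unity_eq)
  then show "finite (tor ` {\<nu>. \<nu> ^ n = 1})"
    using assms card_gt_0_iff by metis
qed

lemma card_dominated_PGL_le:
  assumes n: "n > 0" and z: "z \<in> inert (Conj (int n) (PGL :: (complex ^ 2 ^ 2) set monoid))"
  shows "card (dominated (Conj (int n) PGL) z) \<le> n"
proof -
  have z': "z \<in> carrier PGL" "z [^]\<^bsub>PGL\<^esub> n = \<one>\<^bsub>PGL\<^esub>"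
    using z by (auto simp: inert_PGL_iff)
  obtain g \<mu> where g: "g \<in> carrier PGL" and \<mu>: "\<mu> \<noteq> 0"
    and conj: "inv\<^bsub>PGL\<^esub> g \<otimes>\<^bsub>PGL\<^esub> z \<otimes>\<^bsub>PGL\<^esub> g = tor \<mu>"
    using torsion_conjugate_into_torus[OF z' n] .
  have "card (dominated (Conj (int n) PGL) z) = card (dominated (Conj (int n) PGL) (tor \<mu>))"
    using quandle_iso_card_dominated[OF PGL.quandle_Conj PGL.inner_automorphism[OF g], of z n] z'
    by (simp add: conj)
  also have "\<dots> \<le> n"
    using card_mono[OF card_tor_roots_unity(1)[OF n] dominated_tor_subset[OF \<mu> n]]
    by (simp add: card_tor_roots_unity(2)[OF n])
  finally show ?thesis .
qed

text \<open>
  The \<open>n\<close>-torsion of the torus is cyclic, and its generator \<open>tor \<zeta>\<close> dominates its own powers.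
\<close>

lemma card_dominated_PGL_attained:
  assumes n: "n > 0"
  obtains z where "z \<in> inert (Conj (int n) (PGL :: (complex ^ 2 ^ 2) set monoid))"
    and "card (dominated (Conj (int n) PGL) z) = n"
proof -
  define \<zeta> where "\<zeta> = cis (2 * pi / n)"
  have "\<zeta> ^ n = cis (real n * (2 * pi / n))"
    unfolding \<zeta>_def by (rule Complex.DeMoivre)
  then have \<zeta>: "\<zeta> \<noteq> 0" "\<zeta> ^ n = 1"
    using n by (simp_all add: \<zeta>_def)
  have inert: "tor \<nu> \<in> inert (Conj (int n) PGL)" if "\<nu> ^ n = 1" for \<nu>
  proof -
    have "\<nu> \<noteq> 0" using that n by (auto simp: power_0_left)
    then show ?thesis using that by (simp add: inert_PGL_iff tor_closed tor_pow tor_1)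
  qed
  have "tor \<nu> \<in> dominated (Conj (int n) PGL) (tor \<zeta>)" if \<nu>: "\<nu> ^ n = 1" for \<nu>
  proof -
    have "\<nu> \<in> (\<lambda>k. cis (2 * pi * real k / real n)) ` {..<n}"
      using Complex.bij_betw_roots_unity[OF n] \<nu> by (simp add: bij_betw_def)
    then obtain k where "\<nu> = \<zeta> ^ k"
      by (auto simp: \<zeta>_def Complex.DeMoivre mult_ac)
    then have pow: "tor \<nu> = tor \<zeta> [^]\<^bsub>PGL\<^esub> k" using \<zeta> by (simp add: tor_pow)
    have "fixers (Conj (int n) PGL) (tor \<zeta>) \<subseteq> fixers (Conj (int n) PGL) (tor \<nu>)"
      using \<zeta> by (auto simp: pow PGL.fixers_Conj tor_closed PGL.group_commutes_pow)
    then show ?thesis using inert[OF \<nu>] by (simp add: dominated_def)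
  qed
  then have "dominated (Conj (int n) PGL) (tor \<zeta>) = tor ` {\<nu>. \<nu> ^ n = 1}"
    using dominated_tor_subset[OF \<zeta>(1) n] by blast
  then show ?thesis
    using that[OF inert[OF \<zeta>(2)]] card_tor_roots_unity(2)[OF n] by simp
qed

lemma Conj_PGL_isomorphic_imp_le:
  assumes "Conj (int m) (PGL :: (complex ^ 2 ^ 2) set monoid) \<cong>\<^sub>q
      Conj (int n) (PGL :: (complex ^ 2 ^ 2) set monoid)"
    and m: "m > 0" and n: "n > 0"
  shows "m \<le> n" "n \<le> m"
proof -
  let ?M = "Conj (int m) (PGL :: (complex ^ 2 ^ 2) set monoid)"
  let ?N = "Conj (int n) (PGL :: (complex ^ 2 ^ 2) set monoid)"
  obtain \<phi> where \<phi>: "\<phi> \<in> quandle_iso ?M ?N"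
    using assms(1) by (auto simp: quandle_isomorphic_def)
  have Q: "quandle ?M" by (rule PGL.quandle_Conj)
  have sub: "inert ?M \<subseteq> carrier ?M" by (auto simp: inert_def)
  obtain z where z: "z \<in> inert ?M" "card (dominated ?M z) = m"
    using card_dominated_PGL_attained[OF m] .
  have "m = card (dominated ?N (\<phi> z))"
    using quandle_iso_card_dominated[OF Q \<phi>] z sub by auto
  moreover have "\<phi> z \<in> inert ?N" using quandle_iso_inert[OF Q \<phi>] z by simp
  ultimately show "m \<le> n" using card_dominated_PGL_le[OF n] by metis
  obtain w where w: "w \<in> inert ?N" "card (dominated ?N w) = n"
    using card_dominated_PGL_attained[OF n] .
  then obtain v where v: "v \<in> inert ?M" "w = \<phi> v" using quandle_iso_inert[OF Q \<phi>] by auto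
  then have "n = card (dominated ?M v)"
    using quandle_iso_card_dominated[OF Q \<phi>] w sub by auto
  then show "n \<le> m" using card_dominated_PGL_le[OF m v(1)] by metis
qed

theorem theorem5p16:
  fixes m n :: int
  assumes "m > 0" and "n > 0" and "m \<noteq> n"
  shows "\<not> Conj m (PGL :: (complex ^ 2 ^ 2) set monoid) \<cong>\<^sub>q Conj n (PGL :: (complex ^ 2 ^ 2) set monoid)"
  using Conj_PGL_isomorphic_imp_le[of "nat m" "nat n"] assms by auto

end
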